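(* Let $d_1>d_2>\cdots$ be an infinite sequence with $d_i>0$ and $d_i\to0$. For all $\varepsilon>0$, $\varsigma>0$ there exist constants $a,b>0$, depending only on $\varepsilon,\varsigma$ and the sequence $(d_i)$ (in particular not on the dimension $n$), such that the following holds for all $n\ge1$ and $N\ge1$. Let $D\subset\mathbb{R}^n$ be the union of $N$ elliptic granules $\mathbf{S}_{\boldsymbol{z},E,A}$ with centres $\boldsymbol{z}\in\mathbb{B}_n$ and semi-axes satisfying $a_i\le d_i$ ($i=1,\dots,n$). Let $\boldsymbol{x}\in\mathbb{B}_n$ be a random point from a distribution in the unit ball with bounded probability density $\rho(\boldsymbol{x})\le\rho_{\max}$. Then $$\mathbf{P}\big((\boldsymbol{x},\boldsymbol{z}')<\varepsilon\ \text{for all }\boldsymbol{z}'\in D,\ \text{and}\ (\boldsymbol{x},\boldsymbol{x})>1-\varsigma\big)>1-N\rho_{\max}V_n(\mathbb{B}_n)\,a\exp(-bn).$$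
   Context: $(\cdot,\cdot)$ is the standard inner product on $\mathbb{R}^n$; $\mathbb{B}_n$ is the unit ball of $\mathbb{R}^n$ centred at the origin and $V_n(\mathbb{B}_n)$ is its volume. An elliptic granule in $\mathbb{R}^n$ with centre $\boldsymbol{z}$, orthonormal basis of principal axes $E=\{\boldsymbol{e}_1,\dots,\boldsymbol{e}_n\}$ and semi-axes $A=\{a_1\ge a_2\ge\dots\ge a_n\}$, $a_i>0$, is $$\mathbf{S}_{\boldsymbol{z},E,A}=\Big\{\boldsymbol{z}'\in\mathbb{R}^n : \sum_{j=1}^n\frac{1}{a_j^2}(\boldsymbol{z}'-\boldsymbol{z},\boldsymbol{e}_j)^2\le1\Big\}.$$ *)

theory Defs
  imports "HOL-Probability.Probability"
begin

text \<open>
  The dimension \<open>n\<close> is quantified under the existential quantifier over the constants, so it cannot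
  be a type. Vectors of \<open>\<real>\<^sup>n\<close> are functions on the index set \<open>{..<n}\<close> (extensional, that is,
  \<^const>\<open>undefined\<close> outside it), and \<open>lborel_n n\<close> is \<open>n\<close>-dimensional Lebesgue measure on them.
  All indices start from 0.
\<close>

definition lborel_n :: "nat \<Rightarrow> (nat \<Rightarrow> real) measure" where
  "lborel_n n = (\<Pi>\<^sub>M i\<in>{..<n}. lborel)"

definition Rn :: "nat \<Rightarrow> (nat \<Rightarrow> real) set" where
  "Rn n = {..<n} \<rightarrow>\<^sub>E UNIV"

lemma space_lborel_n: "space (lborel_n n) = Rn n"
  by (simp add: lborel_n_def Rn_def space_PiM)

definition inner_n :: "nat \<Rightarrow> (nat \<Rightarrow> real) \<Rightarrow> (nat \<Rightarrow> real) \<Rightarrow> real" where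
  "inner_n n x y = (\<Sum>i<n. x i * y i)"

definition diff_n :: "nat \<Rightarrow> (nat \<Rightarrow> real) \<Rightarrow> (nat \<Rightarrow> real) \<Rightarrow> (nat \<Rightarrow> real)" where
  "diff_n n x y = (\<lambda>i\<in>{..<n}. x i - y i)"

definition unit_ball :: "nat \<Rightarrow> (nat \<Rightarrow> real) set" where
  "unit_ball n = {x \<in> Rn n. inner_n n x x \<le> 1}"

definition orthonormal_basis :: "nat \<Rightarrow> (nat \<Rightarrow> nat \<Rightarrow> real) \<Rightarrow> bool" where
  "orthonormal_basis n e \<longleftrightarrow>
     (\<forall>j<n. e j \<in> Rn n) \<and>
     (\<forall>i<n. \<forall>j<n. inner_n n (e i) (e j) = (if i = j then 1 else 0)) \<and>
     (\<forall>x\<in>Rn n. \<exists>c. \<forall>i<n. x i = (\<Sum>j<n. c j * e j i))"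

definition semi_axes :: "nat \<Rightarrow> (nat \<Rightarrow> real) \<Rightarrow> bool" where
  "semi_axes n \<alpha> \<longleftrightarrow> (\<forall>j<n. 0 < \<alpha> j) \<and> (\<forall>i j. i \<le> j \<and> j < n \<longrightarrow> \<alpha> j \<le> \<alpha> i)"

definition granule ::
    "nat \<Rightarrow> (nat \<Rightarrow> real) \<Rightarrow> (nat \<Rightarrow> nat \<Rightarrow> real) \<Rightarrow> (nat \<Rightarrow> real) \<Rightarrow> (nat \<Rightarrow> real) set" where
  "granule n z e \<alpha> =
     {z' \<in> Rn n. (\<Sum>j<n. 1 / (\<alpha> j)\<^sup>2 * (inner_n n (diff_n n z' z) (e j))\<^sup>2) \<le> 1}"

definition ball_density :: "nat \<Rightarrow> ((nat \<Rightarrow> real) \<Rightarrow> real) \<Rightarrow> bool" where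
  "ball_density n \<rho> \<longleftrightarrow>
     \<rho> \<in> borel_measurable (lborel_n n) \<and>
     (\<forall>x\<in>Rn n. 0 \<le> \<rho> x) \<and>
     (\<forall>x\<in>Rn n - unit_ball n. \<rho> x = 0) \<and>
     prob_space (density (lborel_n n) \<rho>)"

end

theory Submission
  imports Defs
begin

text \<open>
  The supremum of \<open>(x, \<cdot>)\<close> over a granule is \<open>(x, z) + sqrt (\<Sum>j. \<alpha>\<^sub>j\<^sup>2 (x, e\<^sub>j)\<^sup>2)\<close>. Choose \<open>m\<close> with
  \<open>d\<^sub>j < \<epsilon>/4\<close> for \<open>j \<ge> m\<close>: since \<open>(x, x) \<le> 1\<close>, the terms with \<open>j \<ge> m\<close> are harmless by Parseval, so
  the supremum can reach \<open>\<epsilon>\<close> only if \<open>(x, z)\<close> or one of the first \<open>m\<close> coordinates \<open>\<bar>(x, e\<^sub>j)\<bar>\<close> is at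
  least a constant \<open>\<delta>\<close>. Hence the exceptional points lie in at most \<open>2 m + 1\<close> caps of height \<open>\<delta>\<close> per
  granule and in one concentric ball. Each of these sits in a ball of radius
  \<open>r = sqrt (1 - \<delta>\<^sup>2) < 1\<close>, of volume \<open>r\<^sup>n V\<^sub>n\<close>, and neither \<open>m\<close> nor \<open>\<delta>\<close> depends on \<open>n\<close>.
\<close>

section \<open>Orthonormal coordinates and the support function of a granule\<close>

lemma inner_n_commute: "inner_n n x y = inner_n n y x"
  by (simp add: inner_n_def mult.commute)

lemma inner_n_combination:
  assumes "\<And>i. i < n \<Longrightarrow> x i = (\<Sum>j<m. c j * e j i)"
  shows "inner_n n x y = (\<Sum>j<m. c j * inner_n n (e j) y)"
proof -
  have "inner_n n x y = (\<Sum>i<n. \<Sum>j<m. c j * (e j i * y i))"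
    by (simp add: inner_n_def assms sum_distrib_right mult.assoc)
  also have "\<dots> = (\<Sum>j<m. \<Sum>i<n. c j * (e j i * y i))"
    by (rule sum.swap)
  finally show ?thesis
    by (simp add: inner_n_def sum_distrib_left)
qed

lemma inner_n_diff_n: "inner_n n (diff_n n x z) y = inner_n n x y - inner_n n z y"
  by (simp add: inner_n_def diff_n_def sum_subtractf left_diff_distrib)

lemma diff_n_in_Rn: "diff_n n x y \<in> Rn n"
  by (simp add: Rn_def diff_n_def)

lemma orthonormal_basis_coefficient:
  assumes "orthonormal_basis n e" "k < n" "\<And>i. i < n \<Longrightarrow> x i = (\<Sum>j<n. c j * e j i)"
  shows "inner_n n x (e k) = c k"
proof -
  have "inner_n n x (e k) = (\<Sum>j<n. c j * inner_n n (e j) (e k))"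
    using assms(3) by (rule inner_n_combination)
  also have "\<dots> = (\<Sum>j<n. if j = k then c j else 0)"
    using assms(1,2) by (intro sum.cong) (auto simp: orthonormal_basis_def)
  finally show ?thesis
    using assms(2) by simp
qed

text \<open>Orthonormality identifies the coefficients of \<open>x\<close> in the basis with its
  inner products \<open>inner_n n x (e j)\<close>; pairing the expansion with \<open>y\<close> gives
  the sum.\<close>

lemma orthonormal_basis_parseval:
  assumes "orthonormal_basis n e" "x \<in> Rn n"
  shows "inner_n n x y = (\<Sum>j<n. inner_n n x (e j) * inner_n n y (e j))"
proof -
  obtain c where c: "\<And>i. i < n \<Longrightarrow> x i = (\<Sum>j<n. c j * e j i)"
    using assms by (auto simp: orthonormal_basis_def)
  have "inner_n n x y = (\<Sum>j<n. c j * inner_n n (e j) y)"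
    using c by (rule inner_n_combination)
  also have "\<dots> = (\<Sum>j<n. inner_n n x (e j) * inner_n n y (e j))"
    by (intro sum.cong) (auto simp: orthonormal_basis_coefficient[OF assms(1) _ c] inner_n_commute)
  finally show ?thesis .
qed

text \<open>
  The left-hand side is an intersection of uncountably many conditions; the closed form makes it
  measurable in \<open>x\<close>.
\<close>

lemma granule_halfspace_iff:
  assumes e: "orthonormal_basis n e" and \<alpha>: "\<And>j. j < n \<Longrightarrow> 0 < \<alpha> j"
  shows "(\<forall>z'\<in>granule n z e \<alpha>. inner_n n x z' < \<epsilon>) \<longleftrightarrow>
    inner_n n x z + sqrt (\<Sum>j<n. (\<alpha> j)\<^sup>2 * (inner_n n x (e j))\<^sup>2) < \<epsilon>"
proof -
  define t where "t j = inner_n n x (e j)" for j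
  define Q where "Q = (\<Sum>j<n. (\<alpha> j)\<^sup>2 * (t j)\<^sup>2)"
  have Q0: "0 \<le> Q"
    unfolding Q_def by (intro sum_nonneg) auto
  \<comment> \<open>Weighted Cauchy-Schwarz: pairing \<open>\<alpha> j * t j\<close> with
    \<open>s j / \<alpha> j\<close> makes the second sum of squares exactly the granule's defining
    sum, which is at most 1.\<close>
  have upper: "inner_n n x z' \<le> inner_n n x z + sqrt Q" if z': "z' \<in> granule n z e \<alpha>" for z'
  proof -
    define w where "w = diff_n n z' z"
    define s where "s j = inner_n n w (e j)" for j
    have "inner_n n w x = (\<Sum>j<n. s j * t j)"
      unfolding s_def t_def w_def by (rule orthonormal_basis_parseval[OF e diff_n_in_Rn])
    also have "\<dots> = (\<Sum>j<n. (\<alpha> j * t j) * (s j / \<alpha> j))"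
      by (intro sum.cong refl) (use \<alpha> in force)
    finally have "(inner_n n w x)\<^sup>2 = (\<Sum>j<n. (\<alpha> j * t j) * (s j / \<alpha> j))\<^sup>2"
      by simp
    also have "\<dots> \<le> (\<Sum>j<n. (\<alpha> j * t j)\<^sup>2) * (\<Sum>j<n. (s j / \<alpha> j)\<^sup>2)"
      by (rule Cauchy_Schwarz_ineq_sum)
    also have "\<dots> \<le> Q * 1"
      using z' Q0 by (intro mult_mono sum_nonneg)
        (auto simp: Q_def granule_def s_def w_def power_mult_distrib power_divide)
    finally have "inner_n n w x \<le> sqrt Q"
      by (simp add: real_le_rsqrt)
    then show ?thesis
      by (simp add: w_def inner_n_diff_n inner_n_commute[of n x])
  qed
  \<comment> \<open>Coordinates of the maximiser relative to \<open>z\<close>, from the equality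
    case of Cauchy-Schwarz. If \<open>Q = 0\<close>, division by zero yields 0 and the witness is
    the centre.\<close>
  define \<beta> where "\<beta> j = (\<alpha> j)\<^sup>2 * t j / sqrt Q" for j
  define z' where "z' = (\<lambda>i\<in>{..<n}. z i + (\<Sum>j<n. \<beta> j * e j i))"
  have diff: "diff_n n z' z i = (\<Sum>j<n. \<beta> j * e j i)" if "i < n" for i
    using that by (simp add: diff_n_def z'_def)
  have "(\<Sum>j<n. 1 / (\<alpha> j)\<^sup>2 * (inner_n n (diff_n n z' z) (e j))\<^sup>2) = (\<Sum>j<n. (\<alpha> j)\<^sup>2 * (t j)\<^sup>2 / Q)"
  proof (rule sum.cong[OF refl])
    fix j assume "j \<in> {..<n}"
    then have "j < n" "\<alpha> j \<noteq> 0"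
      using \<alpha>[of j] by auto
    then show "1 / (\<alpha> j)\<^sup>2 * (inner_n n (diff_n n z' z) (e j))\<^sup>2 = (\<alpha> j)\<^sup>2 * (t j)\<^sup>2 / Q"
      using Q0 orthonormal_basis_coefficient[OF e \<open>j < n\<close> diff]
      by (simp add: \<beta>_def power_divide power_mult_distrib) (simp add: power2_eq_square power4_eq_xxxx)
  qed
  \<comment> \<open>This is 1, or 0 when \<open>Q = 0\<close>; either way the witness lies in the
    granule.\<close>
  also have "\<dots> = Q / Q"
    unfolding Q_def by (simp only: sum_divide_distrib)
  finally have z': "z' \<in> granule n z e \<alpha>"
    by (auto simp: granule_def z'_def Rn_def)
  have "inner_n n (diff_n n z' z) x = (\<Sum>j<n. \<beta> j * t j)"
    using inner_n_combination[OF diff] by (simp add: t_def inner_n_commute)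
  also have "\<dots> = Q / sqrt Q"
    by (simp add: \<beta>_def Q_def sum_divide_distrib power2_eq_square mult.assoc)
  also have "\<dots> = sqrt Q"
    using Q0 by (simp add: real_div_sqrt)
  finally have attained: "inner_n n x z' = inner_n n x z + sqrt Q"
    by (simp add: inner_n_diff_n inner_n_commute[of n x])
  \<comment> \<open>Attainment is what lets the strict inequality pass from all points of the
    granule to the supremum.\<close>
  show ?thesis
    using upper attained z' unfolding Q_def t_def by (metis order_le_less_trans)
qed

section \<open>Measurability and the volume of balls\<close>

lemma measurable_inner_n [measurable]:
  assumes [measurable]: "\<And>i. i < n \<Longrightarrow> (\<lambda>x. f x i) \<in> borel_measurable M"
    "\<And>i. i < n \<Longrightarrow> (\<lambda>x. g x i) \<in> borel_measurable M"
  shows "(\<lambda>x. inner_n n (f x) (g x)) \<in> borel_measurable M"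
  unfolding inner_n_def by measurable

lemma measurable_component_lborel_n [measurable]:
  assumes "i < n"
  shows "(\<lambda>x. x i) \<in> borel_measurable (lborel_n n)"
  using assms unfolding lborel_n_def by simp

lemma measurable_inner_n_diff_n [measurable]:
  "(\<lambda>x. inner_n n (diff_n n x c) (diff_n n x c)) \<in> borel_measurable (lborel_n n)"
proof -
  have "(\<lambda>x. inner_n n (diff_n n x c) (diff_n n x c)) = (\<lambda>x. \<Sum>i<n. (x i - c i) * (x i - c i))"
    by (simp add: inner_n_def diff_n_def)
  also have "\<dots> \<in> borel_measurable (lborel_n n)"
    by measurable
  finally show ?thesis .
qed

text \<open>The affine map \<open>T\<close> scales Lebesgue measure by \<open>r\<close> in every
  coordinate and carries the unit ball onto this ball. Only the ratio of the volumes is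
  computed.\<close>

lemma emeasure_ball:
  assumes r: "0 < r"
  shows "emeasure (lborel_n n) {x \<in> Rn n. inner_n n (diff_n n x c) (diff_n n x c) \<le> r\<^sup>2}
    = ennreal (r ^ n) * emeasure (lborel_n n) (unit_ball n)"
proof -
  interpret product_sigma_finite "\<lambda>i::nat. lborel :: real measure" ..
  define T where "T = (\<lambda>x. \<lambda>i\<in>{..<n}. c i + r * x i)"
  define P where "P = density (distr (lborel_n n) (lborel_n n) T) (\<lambda>_. ennreal (r ^ n))"
  have T: "T \<in> measurable (lborel_n n) (lborel_n n)"
    unfolding T_def lborel_n_def by measurable
  \<comment> \<open>A product measure is determined by its values on boxes. Since \<open>T\<close>
    acts on each coordinate separately, the preimage of a box is a box and the claim reduces to
    dimension one.\<close>
  have "P = lborel_n n"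
    unfolding lborel_n_def
  proof (rule PiM_eqI)
    show "sets P = sets (Pi\<^sub>M {..<n} (\<lambda>_. lborel))"
      by (simp add: P_def lborel_n_def)
    fix A :: "nat \<Rightarrow> real set" assume A: "\<And>i. i \<in> {..<n} \<Longrightarrow> A i \<in> sets lborel"
    have A': "Pi\<^sub>E {..<n} A \<in> sets (lborel_n n)"
      unfolding lborel_n_def using A by (intro sets_PiM_I_finite) auto
    have pre: "(\<lambda>x. c i + r * x) -` A i \<in> sets lborel" if "i < n" for i
      using that A[of i] measurable_sets[of "\<lambda>x. c i + r * x" borel borel "A i"] by simp
    have "emeasure P (Pi\<^sub>E {..<n} A)
        = ennreal (r ^ n) * emeasure (lborel_n n) (T -` Pi\<^sub>E {..<n} A \<inter> space (lborel_n n))"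
      using A' T by (simp add: P_def emeasure_density nn_integral_cmult_indicator emeasure_distr)
    also have "T -` Pi\<^sub>E {..<n} A \<inter> space (lborel_n n) = Pi\<^sub>E {..<n} (\<lambda>i. (\<lambda>x. c i + r * x) -` A i)"
      by (auto simp: T_def space_lborel_n Rn_def PiE_iff)
    also have "emeasure (lborel_n n) \<dots> = (\<Prod>i<n. emeasure lborel ((\<lambda>x. c i + r * x) -` A i))"
      unfolding lborel_n_def using pre by (intro emeasure_PiM) auto
    also have "ennreal (r ^ n) * \<dots> = (\<Prod>i<n. ennreal r * emeasure lborel ((\<lambda>x. c i + r * x) -` A i))"
      using r by (simp add: prod.distrib ennreal_power)
    also have "\<dots> = (\<Prod>i<n. emeasure lborel (A i))"
    proof (rule prod.cong[OF refl])
      fix i assume "i \<in> {..<n}"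
      then have Ai: "A i \<in> sets borel"
        using A by simp
      have "emeasure lborel (A i)
          = emeasure (density (distr lborel borel (\<lambda>x. c i + r * x)) (\<lambda>_. ennreal \<bar>r\<bar>)) (A i)"
        using lborel_real_affine[of r "c i"] r by simp
      also have "\<dots> = ennreal r * emeasure lborel ((\<lambda>x. c i + r * x) -` A i)"
        using Ai r by (simp add: emeasure_density nn_integral_cmult_indicator emeasure_distr)
      finally show "ennreal r * emeasure lborel ((\<lambda>x. c i + r * x) -` A i) = emeasure lborel (A i)" ..
    qed
    finally show "emeasure P (Pi\<^sub>E {..<n} A) = (\<Prod>i\<in>{..<n}. emeasure lborel (A i))" .
  qed simp
  moreover define B where "B = {x \<in> Rn n. inner_n n (diff_n n x c) (diff_n n x c) \<le> r\<^sup>2}"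
  have B: "B \<in> sets (lborel_n n)"
    unfolding B_def space_lborel_n[symmetric] by measurable
  have "T -` B \<inter> space (lborel_n n) = unit_ball n"
  proof -
    have "inner_n n (diff_n n (T x) c) (diff_n n (T x) c) = r\<^sup>2 * inner_n n x x" for x
      by (simp add: inner_n_def diff_n_def T_def sum_distrib_left power2_eq_square algebra_simps)
    then show ?thesis
      using r by (auto simp: B_def unit_ball_def space_lborel_n T_def Rn_def)
  qed
  then have "emeasure P B = ennreal (r ^ n) * emeasure (lborel_n n) (unit_ball n)"
    using B T by (simp add: P_def emeasure_density nn_integral_cmult_indicator emeasure_distr)
  ultimately show ?thesis
    by (simp add: B_def)
qed

lemma sets_unit_ball [measurable]: "unit_ball n \<in> sets (lborel_n n)"
  unfolding unit_ball_def space_lborel_n[symmetric] by measurable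

text \<open>The ball sits in the cube of side 2. Finiteness matters because the real-valued
  \<open>measure\<close> returns 0 on sets of infinite volume.\<close>

lemma emeasure_unit_ball_finite: "emeasure (lborel_n n) (unit_ball n) < \<infinity>"
proof -
  interpret product_sigma_finite "\<lambda>i::nat. lborel :: real measure" ..
  have "unit_ball n \<subseteq> Pi\<^sub>E {..<n} (\<lambda>_. {-1..1})"
  proof
    fix x assume x: "x \<in> unit_ball n"
    have "\<bar>x i\<bar> \<le> 1" if "i < n" for i
    proof -
      have "x i * x i \<le> inner_n n x x"
        unfolding inner_n_def using that by (intro member_le_sum[of i _ "\<lambda>i. x i * x i"]) auto
      also have "\<dots> \<le> 1"
        using x by (simp add: unit_ball_def)
      finally show ?thesis
        by (simp add: abs_square_le_1[symmetric] power2_eq_square)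
    qed
    then show "x \<in> Pi\<^sub>E {..<n} (\<lambda>_. {-1..1})"
      using x by (auto simp: unit_ball_def Rn_def PiE_iff abs_le_iff)
  qed
  then have "emeasure (lborel_n n) (unit_ball n) \<le> emeasure (lborel_n n) (Pi\<^sub>E {..<n} (\<lambda>_. {-1..1}))"
    unfolding lborel_n_def by (intro emeasure_mono sets_PiM_I_finite) auto
  also have "\<dots> < \<infinity>"
    unfolding lborel_n_def by (subst emeasure_PiM) (auto simp: power_less_top_ennreal)
  finally show ?thesis .
qed

text \<open>The centre \<open>c\<close> is left free to serve both the caps, with a shifted centre,
  and the concentric ball, with centre 0.\<close>

lemma measure_subset_ball_le:
  assumes "0 < r" "A \<in> sets (lborel_n n)"
    "\<And>x. x \<in> A \<Longrightarrow> x \<in> Rn n \<and> inner_n n (diff_n n x c) (diff_n n x c) \<le> r\<^sup>2"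
  shows "measure (lborel_n n) A \<le> r ^ n * measure (lborel_n n) (unit_ball n)"
proof -
  define B where "B = {x \<in> Rn n. inner_n n (diff_n n x c) (diff_n n x c) \<le> r\<^sup>2}"
  have "B \<in> sets (lborel_n n)"
    unfolding B_def space_lborel_n[symmetric] by measurable
  moreover have eB: "emeasure (lborel_n n) B = ennreal (r ^ n) * emeasure (lborel_n n) (unit_ball n)"
    unfolding B_def by (rule emeasure_ball[OF assms(1)])
  ultimately have "B \<in> fmeasurable (lborel_n n)"
    using emeasure_unit_ball_finite[of n] by (auto simp: fmeasurable_def ennreal_mult_less_top)
  then have "measure (lborel_n n) A \<le> measure (lborel_n n) B"
    using assms by (intro measure_mono_fmeasurable) (auto simp: B_def)
  also have "\<dots> = r ^ n * measure (lborel_n n) (unit_ball n)"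
    using assms(1) by (simp add: measure_def eB enn2real_mult)
  finally show ?thesis .
qed

section \<open>Spherical caps and the points that avoid them\<close>

text \<open>The direction \<open>u\<close> is not normalised, because it stands for the centre of a
  granule as well as for a principal axis with either sign.\<close>

definition cap :: "nat \<Rightarrow> real \<Rightarrow> (nat \<Rightarrow> real) \<Rightarrow> (nat \<Rightarrow> real) set" where
  "cap n \<delta> u = {x \<in> unit_ball n. \<delta> \<le> inner_n n x u}"

lemma sets_cap [measurable]: "cap n \<delta> u \<in> sets (lborel_n n)"
proof -
  have "cap n \<delta> u = {x \<in> space (lborel_n n). x \<in> unit_ball n \<and> \<delta> \<le> inner_n n x u}"
    by (auto simp: cap_def unit_ball_def space_lborel_n)
  also have "\<dots> \<in> sets (lborel_n n)"
    by measurable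
  finally show ?thesis .
qed

text \<open>The cap lies in the ball of radius \<open>sqrt (1 - \<delta>\<^sup>2)\<close> centred at \<open>\<delta> u\<close>.\<close>

lemma measure_cap_le:
  assumes "0 < \<delta>" "\<delta> < 1" "inner_n n u u \<le> 1"
  shows "measure (lborel_n n) (cap n \<delta> u) \<le> sqrt (1 - \<delta>\<^sup>2) ^ n * measure (lborel_n n) (unit_ball n)"
proof (rule measure_subset_ball_le[where c = "\<lambda>i. \<delta> * u i"])
  show "0 < sqrt (1 - \<delta>\<^sup>2)"
    using assms by (simp add: power_less_one_iff)
  fix x assume x: "x \<in> cap n \<delta> u"
  have "inner_n n (diff_n n x (\<lambda>i. \<delta> * u i)) (diff_n n x (\<lambda>i. \<delta> * u i))
      = inner_n n x x - 2 * \<delta> * inner_n n x u + \<delta>\<^sup>2 * inner_n n u u"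
    by (simp add: inner_n_def diff_n_def sum_distrib_left sum_subtractf[symmetric]
        sum.distrib[symmetric] power2_eq_square algebra_simps)
  \<comment> \<open>Termwise bounds: \<open>x\<close> is in the unit ball, its inner product with
    \<open>u\<close> is at least \<open>\<delta>\<close>, and \<open>u\<close> has norm at most
    1.\<close>
  also have "\<dots> \<le> 1 - 2 * \<delta> * \<delta> + \<delta>\<^sup>2 * 1"
    using x assms by (intro add_mono diff_mono mult_left_mono) (auto simp: cap_def unit_ball_def)
  also have "\<dots> = (sqrt (1 - \<delta>\<^sup>2))\<^sup>2"
    using assms by (simp add: power_le_one_iff power2_eq_square mult_le_one)
  finally show "x \<in> Rn n \<and> inner_n n (diff_n n x (\<lambda>i. \<delta> * u i)) (diff_n n x (\<lambda>i. \<delta> * u i)) \<le> (sqrt (1 - \<delta>\<^sup>2))\<^sup>2"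
    using x by (simp add: cap_def unit_ball_def)
qed (rule sets_cap)

text \<open>Half of \<open>\<epsilon>\<close> is spent on the centre and half on the square root in
  the support function. Under that root the first \<open>m\<close> axes contribute at most
  \<open>\<epsilon>\<^sup>2 / 16\<close> by \<open>mK\<close>, and the remaining axes at most as
  much again by Parseval.\<close>

lemma granule_halfspaceI:
  assumes e: "orthonormal_basis n e" and \<alpha>: "\<And>j. j < n \<Longrightarrow> 0 < \<alpha> j" and x: "x \<in> unit_ball n"
    and "0 < \<epsilon>" and xz: "inner_n n x z < \<epsilon> / 2"
    and xe: "\<And>j. j < n \<Longrightarrow> j < m \<Longrightarrow> \<bar>inner_n n x (e j)\<bar> \<le> \<delta>"
    and K: "\<And>j. j < n \<Longrightarrow> \<alpha> j \<le> K" and tail: "\<And>j. j < n \<Longrightarrow> m \<le> j \<Longrightarrow> \<alpha> j \<le> \<epsilon> / 4"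
    and mK: "real m * (K * \<delta>)\<^sup>2 \<le> \<epsilon>\<^sup>2 / 16"
  shows "\<forall>z'\<in>granule n z e \<alpha>. inner_n n x z' < \<epsilon>"
proof -
  define t where "t j = inner_n n x (e j)" for j
  have "x \<in> Rn n" and "inner_n n x x \<le> 1"
    using x by (auto simp: unit_ball_def)
  then have parseval: "(\<Sum>j<n. (t j)\<^sup>2) \<le> 1"
    using orthonormal_basis_parseval[OF e, of x x] by (simp add: t_def power2_eq_square)
  have "(\<Sum>j<n. (\<alpha> j)\<^sup>2 * (t j)\<^sup>2) \<le> (\<Sum>j<n. (if j < m then (K * \<delta>)\<^sup>2 else 0) + \<epsilon>\<^sup>2 / 16 * (t j)\<^sup>2)"
  proof (rule sum_mono)
    fix j assume "j \<in> {..<n}"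
    then have j: "j < n" by simp
    show "(\<alpha> j)\<^sup>2 * (t j)\<^sup>2 \<le> (if j < m then (K * \<delta>)\<^sup>2 else 0) + \<epsilon>\<^sup>2 / 16 * (t j)\<^sup>2"
    proof (cases "j < m")
      case True
      have "(\<alpha> j * \<bar>t j\<bar>)\<^sup>2 \<le> (K * \<delta>)\<^sup>2"
        using \<alpha>[OF j] K[OF j] xe[OF j True] by (intro power_mono mult_mono) (auto simp: t_def)
      then show ?thesis
        using True by (simp add: power_mult_distrib add_increasing2)
    next
      case False
      have "(\<alpha> j)\<^sup>2 \<le> (\<epsilon> / 4)\<^sup>2"
        using \<alpha>[OF j] tail[OF j] False by (intro power_mono) auto
      then have "(\<alpha> j)\<^sup>2 * (t j)\<^sup>2 \<le> \<epsilon>\<^sup>2 / 16 * (t j)\<^sup>2"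
        by (intro mult_right_mono) (auto simp: power_divide)
      then show ?thesis
        using False by simp
    qed
  qed
  also have "\<dots> = real (card ({..<n} \<inter> {j. j < m})) * (K * \<delta>)\<^sup>2 + \<epsilon>\<^sup>2 / 16 * (\<Sum>j<n. (t j)\<^sup>2)"
    by (simp add: sum.distrib sum_distrib_left sum.If_cases)
  \<comment> \<open>There are \<open>min m n\<close> leading axes; bounding their number by
    \<open>m\<close> removes the dependence on \<open>n\<close>.\<close>
  also have "\<dots> \<le> real m * (K * \<delta>)\<^sup>2 + \<epsilon>\<^sup>2 / 16 * 1"
  proof (intro add_mono mult_mono mult_left_mono parseval)
    have "card ({..<n} \<inter> {j. j < m}) \<le> card {..<m}"
      by (intro card_mono) auto
    then show "real (card ({..<n} \<inter> {j. j < m})) \<le> real m"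
      by simp
  qed (auto intro: sum_nonneg)
  also have "\<dots> < (\<epsilon> / 2)\<^sup>2"
    proof -
    have "0 < \<epsilon>\<^sup>2" "(\<epsilon> / 2)\<^sup>2 = \<epsilon>\<^sup>2 / 4"
      using \<open>0 < \<epsilon>\<close> by (auto simp: power_divide)
    then show ?thesis
      using mK by linarith
  qed
  finally have "sqrt (\<Sum>j<n. (\<alpha> j)\<^sup>2 * (t j)\<^sup>2) < \<epsilon> / 2"
    using \<open>0 < \<epsilon>\<close> by (intro real_less_lsqrt) auto
  then show ?thesis
    using granule_halfspace_iff[where z = z and x = x and \<epsilon> = \<epsilon>, OF e \<alpha>] xz by (simp add: t_def)
qed

section \<open>From volume to probability\<close>

lemma measure_ball_density_le:
  assumes \<rho>: "ball_density n \<rho>" and le: "\<And>x. x \<in> unit_ball n \<Longrightarrow> \<rho> x \<le> \<rho>max"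
    and B: "B \<in> sets (lborel_n n)"
  shows "measure (density (lborel_n n) \<rho>) B \<le> \<rho>max * measure (lborel_n n) (B \<inter> unit_ball n)"
proof -
  have [measurable]: "\<rho> \<in> borel_measurable (lborel_n n)"
    using \<rho> by (simp add: ball_density_def)
  \<comment> \<open>The origin serves as a point where \<open>\<rho>max\<close> bounds a nonnegative
    value, so that \<open>\<rho>max\<close> passes to \<open>ennreal\<close> and back
    unchanged.\<close>
  have "(\<lambda>i\<in>{..<n}. 0) \<in> unit_ball n"
    by (simp add: unit_ball_def Rn_def inner_n_def)
  then have "0 \<le> \<rho>max"
    using \<rho> le by (fastforce simp: ball_density_def unit_ball_def)
  have fin: "emeasure (lborel_n n) (B \<inter> unit_ball n) < \<infinity>"
    using emeasure_mono[of "B \<inter> unit_ball n" "unit_ball n" "lborel_n n"] emeasure_unit_ball_finite[of n]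
    by (auto simp: sets_unit_ball)
  have "emeasure (density (lborel_n n) \<rho>) B = (\<integral>\<^sup>+x. ennreal (\<rho> x) * indicator B x \<partial>lborel_n n)"
    using B by (simp add: emeasure_density)
  also have "\<dots> \<le> (\<integral>\<^sup>+x. ennreal \<rho>max * indicator (B \<inter> unit_ball n) x \<partial>lborel_n n)"
    using \<rho> le by (intro nn_integral_mono)
      (auto simp: space_lborel_n ball_density_def indicator_def intro!: ennreal_leI)
  also have "\<dots> = ennreal \<rho>max * emeasure (lborel_n n) (B \<inter> unit_ball n)"
    using B by (simp add: nn_integral_cmult_indicator sets_unit_ball sets.Int)
  finally have "measure (density (lborel_n n) \<rho>) B
      \<le> enn2real (ennreal \<rho>max * emeasure (lborel_n n) (B \<inter> unit_ball n))"
    unfolding measure_def using fin by (intro enn2real_mono) (auto simp: ennreal_mult_less_top)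
  then show ?thesis
    using \<open>0 \<le> \<rho>max\<close> by (simp add: enn2real_mult measure_def)
qed

theorem theorem3:
  fixes d :: "nat \<Rightarrow> real" and \<epsilon> \<sigma> :: real
  assumes "\<And>i. 0 < d i"
    and "\<And>i j. i < j \<Longrightarrow> d j < d i"
    and "d \<longlonglongrightarrow> 0"
    and "0 < \<epsilon>" and "0 < \<sigma>"
  shows "\<exists>a>0. \<exists>b>0. \<forall>n\<ge>1. \<forall>N\<ge>1.
    \<forall>(z :: nat \<Rightarrow> nat \<Rightarrow> real) (e :: nat \<Rightarrow> nat \<Rightarrow> nat \<Rightarrow> real) (\<alpha> :: nat \<Rightarrow> nat \<Rightarrow> real)
      (D :: (nat \<Rightarrow> real) set) (\<rho> :: (nat \<Rightarrow> real) \<Rightarrow> real) (\<rho>max :: real).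
      (\<forall>k<N. z k \<in> unit_ball n \<and> orthonormal_basis n (e k) \<and> semi_axes n (\<alpha> k)
              \<and> (\<forall>i<n. \<alpha> k i \<le> d i)) \<longrightarrow>
      D = (\<Union>k<N. granule n (z k) (e k) (\<alpha> k)) \<longrightarrow>
      ball_density n \<rho> \<longrightarrow>
      (\<forall>x\<in>unit_ball n. \<rho> x \<le> \<rho>max) \<longrightarrow>
      \<P>(x in density (lborel_n n) \<rho>.
          (\<forall>z'\<in>D. inner_n n x z' < \<epsilon>) \<and> inner_n n x x > 1 - \<sigma>)
        > 1 - real N * \<rho>max * measure (lborel_n n) (unit_ball n) * a * exp (- b * real n)"
proof -

  \<comment> \<open>Constants chosen before the dimension\<close>
  have "eventually (\<lambda>j. d j < \<epsilon> / 4) sequentially"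
    using assms(3,4) by (intro order_tendstoD) auto
  then obtain m where m: "\<And>j. m \<le> j \<Longrightarrow> d j < \<epsilon> / 4"
    by (auto simp: eventually_sequentially)
  have "0 < \<epsilon> / (4 * (real m + 1) * d 0)"
    using assms(1)[of 0] assms(4) by simp
  \<comment> \<open>The bounds in turn give \<open>\<delta> < 1\<close>, place all points with
    squared norm at most \<open>1 - \<sigma>\<close> in the concentric ball, control the centre, and
    control the leading axes, whose lengths are at most \<open>d 0\<close>. Using
    \<open>m + 1\<close> keeps the denominator nonzero when \<open>m = 0\<close>.\<close>
  moreover define \<delta> where "\<delta> = min (min (1/2) \<sigma>) (min (\<epsilon> / 2) (\<epsilon> / (4 * (real m + 1) * d 0)))"
  ultimately have \<delta>: "0 < \<delta>" "\<delta> < 1" "\<delta> \<le> \<sigma>" "\<delta> \<le> \<epsilon> / 2" "\<delta> \<le> \<epsilon> / (4 * (real m + 1) * d 0)"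
    using assms(4,5) by linarith+
  have "\<delta> * \<delta> \<le> 1 * \<sigma>"
    using \<delta> by (intro mult_mono) auto
  then have \<delta>\<sigma>: "\<delta>\<^sup>2 \<le> \<sigma>"
    by (simp add: power2_eq_square)
  have "(real m + 1) * (d 0 * \<delta>) \<le> \<epsilon> / 4"
    using \<delta>(5) assms(1)[of 0] by (simp add: pos_le_divide_eq mult_ac)
  then have "((real m + 1) * (d 0 * \<delta>))\<^sup>2 \<le> (\<epsilon> / 4)\<^sup>2"
    using \<delta>(1) assms(1)[of 0] by (intro power_mono mult_nonneg_nonneg) auto
  moreover have "real m * (d 0 * \<delta>)\<^sup>2 \<le> (real m + 1)\<^sup>2 * (d 0 * \<delta>)\<^sup>2"
    by (rule mult_right_mono) (simp_all add: power2_sum)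
  ultimately have mK: "real m * (d 0 * \<delta>)\<^sup>2 \<le> \<epsilon>\<^sup>2 / 16"
    by (simp add: power_mult_distrib power_divide)
  define r where "r = sqrt (1 - \<delta>\<^sup>2)"
  have "\<delta>\<^sup>2 < 1"
    using \<delta> by (simp add: power_less_one_iff)
  then have r: "0 < r" "r < 1" and r2: "r\<^sup>2 = 1 - \<delta>\<^sup>2"
    using \<delta>(1) by (auto simp: r_def)
  \<comment> \<open>Each granule needs \<open>2 * m + 1\<close> caps, the concentric ball counts as
    one more set, and the last unit makes the final inequality strict.\<close>
  define a where "a = 3 + 2 * real m"
  define b where "b = - ln r"
  have exp_b: "exp (- b * real n) = r ^ n" for n
    using r(1) by (simp add: b_def exp_of_nat2_mult)

  \<comment> \<open>Union bound for fixed dimension, granules and density\<close>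
  have main: "\<P>(x in density (lborel_n n) \<rho>. (\<forall>z'\<in>D. inner_n n x z' < \<epsilon>) \<and> inner_n n x x > 1 - \<sigma>)
      > 1 - real N * \<rho>max * measure (lborel_n n) (unit_ball n) * a * exp (- b * real n)"
    if "1 \<le> N"
      and gr: "\<forall>k<N. z k \<in> unit_ball n \<and> orthonormal_basis n (e k) \<and> semi_axes n (\<alpha> k)
        \<and> (\<forall>i<n. \<alpha> k i \<le> d i)"
      and D: "D = (\<Union>k<N. granule n (z k) (e k) (\<alpha> k))"
      and \<rho>: "ball_density n \<rho>" and \<rho>max: "\<forall>x\<in>unit_ball n. \<rho> x \<le> \<rho>max"
    for n N z e \<alpha> D \<rho> \<rho>max
  proof -
    define L where "L = lborel_n n"
    define V where "V = measure L (unit_ball n)"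
    interpret prob_space "density L \<rho>"
      using \<rho> by (simp add: ball_density_def L_def)
    define good where "good x \<longleftrightarrow> (\<forall>z'\<in>D. inner_n n x z' < \<epsilon>) \<and> inner_n n x x > 1 - \<sigma>" for x
    define G where "G = {x \<in> space (density L \<rho>). good x}"
    have e: "orthonormal_basis n (e k)" and z: "z k \<in> unit_ball n" if "k < N" for k
      using gr that by auto
    have \<alpha>: "0 < \<alpha> k j" "\<alpha> k j \<le> d j" if "k < N" "j < n" for k j
      using gr that by (auto simp: semi_axes_def)
    \<comment> \<open>The support function turns the conditions over all points of \<open>D\<close>
      into one per granule, so \<open>G\<close> is measurable.\<close>
    have "good x \<longleftrightarrow> (\<forall>k<N. inner_n n x (z k) + sqrt (\<Sum>j<n. (\<alpha> k j)\<^sup>2 * (inner_n n x (e k j))\<^sup>2) < \<epsilon>)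
        \<and> inner_n n x x > 1 - \<sigma>" for x
      using granule_halfspace_iff[OF e \<alpha>(1)] by (auto simp: good_def D)
    then have G: "G \<in> events"
      unfolding G_def L_def by simp measurable
    \<comment> \<open>Both signs of each axis occur because the absolute value of the coordinate
      must be small. In dimension below \<open>m\<close> only \<open>n\<close> axes exist, hence
      \<open>min m n\<close>.\<close>
    define cover where "cover k = cap n \<delta> (z k) \<union>
      (\<Union>j<min m n. cap n \<delta> (e k j) \<union> cap n \<delta> (\<lambda>i. - e k j i))" for k
    define core where "core = {x \<in> unit_ball n. inner_n n x x \<le> r\<^sup>2}"
    have "core = unit_ball n \<inter> {x \<in> space (lborel_n n). inner_n n x x \<le> r\<^sup>2}"
      by (auto simp: core_def unit_ball_def space_lborel_n)
    also have "\<dots> \<in> sets (lborel_n n)"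
      by measurable
    finally have core_sets: "core \<in> sets L"
      by (simp add: L_def)
    have cover_sets: "cover k \<in> sets L" for k
      unfolding cover_def L_def by measurable
    \<comment> \<open>By contraposition: a ball point outside all caps meets the premises of
      \<open>granule_halfspaceI\<close> for every granule, and outside \<open>core\<close> its
      squared norm exceeds \<open>1 - \<delta>\<^sup>2\<close>, which is at least
      \<open>1 - \<sigma>\<close>.\<close>
    have covered: "(space (density L \<rho>) - G) \<inter> unit_ball n \<subseteq> core \<union> (\<Union>k<N. cover k)"
    proof (rule subsetI, rule ccontr)
      fix x assume x: "x \<in> (space (density L \<rho>) - G) \<inter> unit_ball n"
        and out: "x \<notin> core \<union> (\<Union>k<N. cover k)"
      have "\<forall>z'\<in>granule n (z k) (e k) (\<alpha> k). inner_n n x z' < \<epsilon>" if k: "k < N" for k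
      proof (rule granule_halfspaceI[where m = m and \<delta> = \<delta> and K = "d 0"])
        have "x \<notin> cover k"
          using out k by auto
        then have not_cap: "x \<notin> cap n \<delta> (z k)"
          and "\<And>j. j < n \<Longrightarrow> j < m \<Longrightarrow> x \<notin> cap n \<delta> (e k j) \<and> x \<notin> cap n \<delta> (\<lambda>i. - e k j i)"
          by (auto simp: cover_def)
        moreover have "inner_n n x (\<lambda>i. - e k j i) = - inner_n n x (e k j)" for j
          by (simp add: inner_n_def sum_negf)
        ultimately show "\<bar>inner_n n x (e k j)\<bar> \<le> \<delta>" if "j < n" "j < m" for j
          using x that by (fastforce simp: cap_def)
        show "inner_n n x (z k) < \<epsilon> / 2"
          using not_cap x \<delta>(4) by (auto simp: cap_def)
        show "\<alpha> k j \<le> d 0" if "j < n" for j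
          using \<alpha>(2)[OF k that] assms(2)[of 0 j] by (cases "j = 0") auto
        show "\<alpha> k j \<le> \<epsilon> / 4" if "j < n" "m \<le> j" for j
          using \<alpha>(2)[OF k that(1)] m[OF that(2)] by simp
      qed (use x e[OF k] \<alpha>(1)[OF k] assms(4) mK in auto)
      moreover have "1 - \<sigma> < inner_n n x x"
        using out x r2 \<delta>\<sigma> by (auto simp: core_def)
      ultimately have "good x"
        by (auto simp: good_def D)
      then show False
        using x by (auto simp: G_def)
    qed
    have V0: "0 \<le> r ^ n * V"
      using r by (simp add: V_def)
    have core_le: "measure L core \<le> r ^ n * V"
      unfolding L_def V_def
    proof (rule measure_subset_ball_le[OF r(1), where c = "\<lambda>_. 0"])
      fix x assume "x \<in> core"
      then show "x \<in> Rn n \<and> inner_n n (diff_n n x (\<lambda>_. 0)) (diff_n n x (\<lambda>_. 0)) \<le> r\<^sup>2"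
        by (simp add: core_def unit_ball_def inner_n_def diff_n_def)
    qed (use core_sets L_def in simp)
    have cap_le: "measure L (cap n \<delta> u) \<le> r ^ n * V" if "inner_n n u u \<le> 1" for u
      unfolding L_def V_def r_def using \<delta>(1,2) that by (rule measure_cap_le)
    have cover_le: "measure L (cover k) \<le> (1 + 2 * real m) * (r ^ n * V)" if k: "k < N" for k
    proof -
      have "inner_n n (z k) (z k) \<le> 1"
        using z[OF k] by (simp add: unit_ball_def)
      then have "measure L (cap n \<delta> (z k)) \<le> r ^ n * V"
        by (rule cap_le)
      moreover have "measure L (cap n \<delta> (e k j) \<union> cap n \<delta> (\<lambda>i. - e k j i)) \<le> 2 * (r ^ n * V)"
        if "j < min m n" for j
      proof -
        have "inner_n n (e k j) (e k j) \<le> 1"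
          using e[OF k] that by (simp add: orthonormal_basis_def)
        moreover have "inner_n n (\<lambda>i. - e k j i) (\<lambda>i. - e k j i) = inner_n n (e k j) (e k j)"
          by (simp add: inner_n_def)
        moreover have "measure L (cap n \<delta> (e k j) \<union> cap n \<delta> (\<lambda>i. - e k j i))
            \<le> measure L (cap n \<delta> (e k j)) + measure L (cap n \<delta> (\<lambda>i. - e k j i))"
          by (rule measure_Un_le) (simp_all add: L_def sets_cap)
        ultimately show ?thesis
          using cap_le[of "e k j"] cap_le[of "\<lambda>i. - e k j i"] by simp
      qed
      moreover have "measure L (cover k) \<le> measure L (cap n \<delta> (z k)) +
          (\<Sum>j<min m n. measure L (cap n \<delta> (e k j) \<union> cap n \<delta> (\<lambda>i. - e k j i)))"
        unfolding cover_def L_def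
        by (intro order_trans[OF measure_Un_le] add_left_mono measure_UNION_le) measurable
      ultimately have "measure L (cover k) \<le> r ^ n * V + (\<Sum>j<min m n. 2 * (r ^ n * V))"
        by (meson add_mono lessThan_iff order_trans sum_mono)
      also have "\<dots> \<le> r ^ n * V + real m * (2 * (r ^ n * V))"
        using V0 by (simp add: mult_right_mono)
      finally show ?thesis
        by (simp add: algebra_simps)
    qed
    have sub_ball: "core \<union> (\<Union>k<N. cover k) \<subseteq> unit_ball n"
      by (auto simp: core_def cover_def cap_def)
    have "unit_ball n \<in> fmeasurable L"
      using emeasure_unit_ball_finite sets_unit_ball by (auto simp: fmeasurable_def L_def)
    then have "core \<union> (\<Union>k<N. cover k) \<in> fmeasurable L"
      using sub_ball core_sets cover_sets by (auto intro: fmeasurableI2)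
    moreover have "(space (density L \<rho>) - G) \<inter> unit_ball n \<in> sets L"
      using sets.compl_sets[OF G] sets_unit_ball by (auto simp: L_def)
    ultimately have "measure L ((space (density L \<rho>) - G) \<inter> unit_ball n)
        \<le> measure L (core \<union> (\<Union>k<N. cover k))"
      using covered by (intro measure_mono_fmeasurable)
    also have "\<dots> \<le> measure L core + (\<Sum>k<N. measure L (cover k))"
      using core_sets cover_sets
      by (intro order_trans[OF measure_Un_le] add_left_mono measure_UNION_le) auto
    also have "\<dots> \<le> r ^ n * V + (\<Sum>k<N. (1 + 2 * real m) * (r ^ n * V))"
      using core_le cover_le by (intro add_mono sum_mono) auto
    \<comment> \<open>As \<open>N\<close> is at least 1, \<open>core\<close> may be charged once per
      granule, so that \<open>N\<close> factors out.\<close>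
    also have "\<dots> \<le> real N * (r ^ n * V) + real N * ((1 + 2 * real m) * (r ^ n * V))"
      using \<open>1 \<le> N\<close> V0 mult_right_mono[of 1 "real N" "r ^ n * V"] by simp
    finally have bad: "measure L ((space (density L \<rho>) - G) \<inter> unit_ball n) \<le> real N * (2 + 2 * real m) * (r ^ n * V)"
      by (simp add: algebra_simps)
    have dens: "prob B \<le> \<rho>max * measure L (B \<inter> unit_ball n)" if "B \<in> events" for B
      unfolding L_def using \<rho> \<rho>max that by (intro measure_ball_density_le) (auto simp: L_def)
    have "unit_ball n \<subseteq> space L"
      by (auto simp: L_def space_lborel_n unit_ball_def)
    \<comment> \<open>Applying the density bound to the whole space, of probability 1, shows that
      \<open>\<rho>max\<close> and \<open>V\<close> are positive; the strict inequality at the end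
      rests on this.\<close>
    then have mass: "1 \<le> \<rho>max * V"
      using dens[OF sets.top] prob_space by (simp add: V_def Int_absorb1)
    then have "0 < \<rho>max"
      using zero_less_mult_iff[of \<rho>max V] measure_nonneg[of L "unit_ball n"] by (simp add: V_def)
    have "1 - prob G = prob (space (density L \<rho>) - G)"
      using prob_compl[OF G] by simp
    also have "\<dots> \<le> \<rho>max * measure L ((space (density L \<rho>) - G) \<inter> unit_ball n)"
      using G by (intro dens sets.compl_sets)
    also have "\<dots> \<le> \<rho>max * (real N * (2 + 2 * real m) * (r ^ n * V))"
      using bad \<open>0 < \<rho>max\<close> by (intro mult_left_mono) auto
    also have "\<dots> = (real N * (\<rho>max * V) * r ^ n) * (2 + 2 * real m)"
      by simp
    \<comment> \<open>Strict because \<open>a\<close> exceeds \<open>2 + 2 * m\<close> and the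
      common factor is positive.\<close>
    also have "\<dots> < (real N * (\<rho>max * V) * r ^ n) * a"
      using r(1) mass \<open>1 \<le> N\<close> by (intro mult_strict_left_mono) (auto simp: a_def)
    finally have "1 - prob G < real N * \<rho>max * V * a * exp (- b * real n)"
      unfolding exp_b by (simp only: mult_ac)
    then show ?thesis
      by (simp add: G_def good_def V_def L_def)
  qed
  have "0 < a" "0 < b"
    using r by (auto simp: a_def b_def)
  with main show ?thesis
    by blast
qed

end
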